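(* The following statement (a conjecture of Blankenship and Oporowski) is false: there exists a function $f$ such that for every graph $G$ and integer $k$, if $G'$ is any $(\leqslant k)$-subdivision of $G$, then $\operatorname{sn}(G)\leqslant f(\operatorname{sn}(G'),k)$.
   Context: Graphs are finite, simple and undirected. Let $G$ be a graph and let $\prec$ be a (strict) total order on $V(G)$. Two disjoint edges $vw,xy\in E(G)$ (edges with no common endpoint) with $v\prec w$ and $x\prec y$ \emph{cross} with respect to $\prec$ if $v\prec x\prec w\prec y$ or $x\prec v\prec y\prec w$. For a function $\varphi:E(G)\to\{1,\ldots,k\}$ with $k\in\mathbb{N}$, the pair $(\prec,\varphi)$ is a \emph{$k$-stack layout} of $G$ if $vw$ and $xy$ do not cross for all edges $vw,xy\in E(G)$ with $\varphi(vw)=\varphi(xy)$. The \emph{stack-number} $\operatorname{sn}(G)$ is the smallest integer $s$ for which $G$ has an $s$-stack layout. A graph $G'$ is a \emph{subdivision} of a graph $G$ if $G'$ can be obtained from $G$ by replacing the edges $vw$ of $G$ by internally disjoint paths $P_{vw}$ with endpoints $v$ and $w$. If each $P_{vw}$ has at most $k$ internal vertices, then $G'$ is a \emph{$(\leqslant k)$-subdivision} of $G$. Here $f$ is a real-valued function of two integer arguments. *)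

theory Defs
  imports Complex_Main
begin

record 'a ugraph =
  verts :: "'a set"
  edges :: "'a set set"

definition fin_simple_graph :: "'a ugraph \<Rightarrow> bool" where
  "fin_simple_graph G \<longleftrightarrow>
     finite (verts G) \<and> (\<forall>e\<in>edges G. e \<subseteq> verts G \<and> card e = 2)"

(* "(a, b) \<in> r" stands for "a precedes b". The edges are vw and xy, with v before w
   and x before y. *)
definition cross :: "('a \<times> 'a) set \<Rightarrow> 'a \<Rightarrow> 'a \<Rightarrow> 'a \<Rightarrow> 'a \<Rightarrow> bool" where
  "cross r v w x y \<longleftrightarrow>
     (v, x) \<in> r \<and> (x, w) \<in> r \<and> (w, y) \<in> r \<or>
     (x, v) \<in> r \<and> (v, y) \<in> r \<and> (y, w) \<in> r"

definition stack_layout ::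
    "nat \<Rightarrow> 'a ugraph \<Rightarrow> ('a \<times> 'a) set \<Rightarrow> ('a set \<Rightarrow> nat) \<Rightarrow> bool" where
  "stack_layout k G r \<phi> \<longleftrightarrow>
     r \<subseteq> verts G \<times> verts G \<and> strict_linear_order_on (verts G) r \<and>
     (\<forall>e\<in>edges G. \<phi> e \<in> {1..k}) \<and>
     (\<forall>v w x y. {v, w} \<in> edges G \<longrightarrow> {x, y} \<in> edges G \<longrightarrow> {v, w} \<inter> {x, y} = {} \<longrightarrow>
        (v, w) \<in> r \<longrightarrow> (x, y) \<in> r \<longrightarrow> \<phi> {v, w} = \<phi> {x, y} \<longrightarrow> \<not> cross r v w x y)"

definition stack_number :: "'a ugraph \<Rightarrow> nat" where
  "stack_number G = (LEAST s. \<exists>r \<phi>. stack_layout s G r \<phi>)"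

(* The minimum defining the stack-number ranges over a nonempty set. *)
lemma ex_stack_layout:
  assumes "fin_simple_graph G"
  shows "\<exists>s r \<phi>. stack_layout s G r \<phi>"
proof -
  have fV: "finite (verts G)" and fE: "finite (edges G)"
    using assms unfolding fin_simple_graph_def
    by (auto intro: finite_subset[of _ "Pow (verts G)"])
  obtain f :: "'a \<Rightarrow> nat" where f: "inj_on f (verts G)"
    using finite_imp_inj_to_nat_seg[OF fV] by blast
  obtain g :: "'a set \<Rightarrow> nat" and n where g: "g ` edges G = {i. i < n}" "inj_on g (edges G)"
    using finite_imp_inj_to_nat_seg[OF fE] by blast
  define r where "r = {(u, v) \<in> verts G \<times> verts G. f u < f v}"
  define \<phi> where "\<phi> e = Suc (g e)" for e
  have "strict_linear_order_on (verts G) r"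
    unfolding strict_linear_order_on_def r_def trans_def irrefl_def total_on_def
    using inj_onD[OF f] by (auto, metis nat_neq_iff)
  moreover have "\<phi> e \<in> {1..n}" if "e \<in> edges G" for e
  proof -
    have "g e \<in> {i. i < n}" using that g(1) by blast
    then show ?thesis unfolding \<phi>_def by simp
  qed
  moreover have "{v, w} = {x, y}"
    if "{v, w} \<in> edges G" "{x, y} \<in> edges G" "\<phi> {v, w} = \<phi> {x, y}" for v w x y
    using that inj_onD[OF g(2)] unfolding \<phi>_def by blast
  moreover have "r \<subseteq> verts G \<times> verts G"
    unfolding r_def by auto
  ultimately have "stack_layout n G r \<phi>"
    unfolding stack_layout_def by (metis Int_absorb insert_not_empty)
  then show ?thesis by blast
qed

definition internal_verts :: "'a list \<Rightarrow> 'a set" where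
  "internal_verts p = set (butlast (tl p))"

definition path_edges :: "'a list \<Rightarrow> 'a set set" where
  "path_edges p = {{p ! i, p ! Suc i} | i. Suc i < length p}"

(* G' arises from G by replacing every edge e with the path P e, given as its sequence of
   vertices; an edge that is not subdivided has a path with two vertices. *)
definition subdivides_via ::
    "('a set \<Rightarrow> 'a list) \<Rightarrow> 'a ugraph \<Rightarrow> 'a ugraph \<Rightarrow> bool" where
  "subdivides_via P G G' \<longleftrightarrow>
     (\<forall>e\<in>edges G. distinct (P e) \<and> 2 \<le> length (P e) \<and> {hd (P e), last (P e)} = e \<and>
        internal_verts (P e) \<inter> verts G = {}) \<and>
     (\<forall>e\<in>edges G. \<forall>e'\<in>edges G. e \<noteq> e' \<longrightarrow>
        internal_verts (P e) \<inter> internal_verts (P e') = {}) \<and>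
     verts G' = verts G \<union> (\<Union>e\<in>edges G. internal_verts (P e)) \<and>
     edges G' = (\<Union>e\<in>edges G. path_edges (P e))"

definition le_subdivision :: "int \<Rightarrow> 'a ugraph \<Rightarrow> 'a ugraph \<Rightarrow> bool" where
  "le_subdivision k G G' \<longleftrightarrow>
     (\<exists>P. subdivides_via P G G' \<and> (\<forall>e\<in>edges G. int (card (internal_verts (P e))) \<le> k))"

end

(* Let G be the Cartesian product of a star with a triangulated grid H, coded on an initial
   segment of nat. All edges of G (and a few more) join t to f t for one of four monotone functions f,
   so subdividing every edge once, with the subdivision vertices placed after all original vertices
   in reverse order of t, gives a layout with 2 stacks per function, that is 8 stacks.

   In an s-stack layout of G with a huge star, Ramsey's theorem yields leaves whose copies of H all
   look alike and are laid out alike relative to each other. Colour a vertex of H by whether its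
   copies increase or decrease with the leaf; by the Hex lemma there is a large monochromatic
   connected set C. Adjacent vertices of C must have interleaved copies, since otherwise two equally
   coloured edges cross; interleaving is transitive, so the copies of C form consecutive blocks.
   Two vertices of C whose star edges have the same colour and whose roots lie on the same side of
   the blocks then give two crossing star edges of the same colour. *)
theory Submission
  imports Defs "HOL-Analysis.Brouwer_Fixpoint" "HOL-Library.Ramsey"
begin

section \<open>Ramsey's theorem for ordered pairs\<close>

text \<open>Ramsey's theorem for 2-subsets, where a set is coloured by reading its two elements in
  increasing order. The colours may come from any finite set, so a colour can later be a tuple of
  relations. Listing the monochromatic set in increasing order gives \<open>l\<close>.\<close>

lemma ramsey_pairs:
  fixes m :: nat
  assumes "finite K"
  shows "\<exists>N. \<forall>f :: nat \<Rightarrow> nat \<Rightarrow> 'k. (\<forall>i j. i < j \<longrightarrow> j < N \<longrightarrow> f i j \<in> K) \<longrightarrow>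
    (\<exists>l c. \<forall>i j. i < j \<longrightarrow> j < m \<longrightarrow> l i < l j \<and> l j < N \<and> f (l i) (l j) = c)"
proof -
  obtain k :: "'k \<Rightarrow> nat" where k: "bij_betw k K {..<card K}"
    using assms ex_bij_betw_finite_nat[of K] by (auto simp: atLeast0LessThan)
  obtain N :: nat where N: "partn_lst {..<N} (replicate (card K) m) 2"
    using ramsey_full by blast
  show ?thesis
  proof (intro exI[of _ N] allI impI)
    fix f :: "nat \<Rightarrow> nat \<Rightarrow> 'k"
    assume f: "\<forall>i j. i < j \<longrightarrow> j < N \<longrightarrow> f i j \<in> K"
    define F where "F e = k (f (Min e) (Max e))" for e
    have F: "F {i, j} = k (f i j)" if "i < j" for i j
      using that by (simp add: F_def min_def max_def)
    have "F e < card K" if "e \<in> nsets {..<N} 2" for e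
    proof -
      obtain i j where "e = {i, j}" "i < j" "j < N"
        using \<open>e \<in> nsets {..<N} 2\<close> unfolding ordered_nsets_2_eq by blast
      then show ?thesis
        using f F bij_betw_apply[OF k] by simp
    qed
    then have "F \<in> nsets {..<N} 2 \<rightarrow> {..<length (replicate (card K) m)}"
      by simp
    then obtain i where i: "i < card K" and "monochromatic {..<N} m 2 F i"
      using N unfolding partn_lst_def by (metis length_replicate nth_replicate)
    then obtain H where H: "H \<subseteq> {..<N}" "card H = m" "finite H" and Fi: "F ` nsets H 2 \<subseteq> {i}"
      unfolding monochromatic_def nsets_def by blast
    define l where "l = (!) (sorted_list_of_set H)"
    have len: "length (sorted_list_of_set H) = m"
      using H by simp
    show "\<exists>l c. \<forall>i j. i < j \<longrightarrow> j < m \<longrightarrow> l i < l j \<and> l j < N \<and> f (l i) (l j) = c"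
    proof (intro exI allI impI)
      fix a b assume ab: "a < b" "b < m"
      have mem: "l a \<in> H" "l b \<in> H"
        using ab len H(3) nth_mem[of _ "sorted_list_of_set H"] by (auto simp: l_def)
      have less: "l a < l b"
        using ab len sorted_wrt_nth_less[of "(<)" "sorted_list_of_set H" a b]
        by (simp add: l_def)
      then have "{l a, l b} \<in> nsets H 2"
        using mem by simp
      then have "F {l a, l b} = i"
        using Fi by blast
      moreover have "f (l a) (l b) \<in> K"
        using f less mem H by auto
      ultimately have "f (l a) (l b) = inv_into K k i"
        using F[OF less] bij_betw_inv_into_left[OF k] by metis
      then show "l a < l b \<and> l b < N \<and> f (l a) (l b) = inv_into K k i"
        using less mem H by auto
    qed
  qed
qed

section \<open>The Hex lemma on the triangulated grid\<close>

definition hex_verts :: "nat \<Rightarrow> (nat \<times> nat) set" where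
  "hex_verts p = {..p} \<times> {..p}"

text \<open>The steps are (1,0), (0,1) and (1,1): a grid with one diagonal in every square, as in
  Kuhn's triangulation. All arcs point upwards, so each step type later becomes one monotone
  function.\<close>

definition hex_arcs :: "nat \<Rightarrow> ((nat \<times> nat) \<times> (nat \<times> nat)) set" where
  "hex_arcs p = {(u, v) \<in> hex_verts p \<times> hex_verts p. u \<noteq> v \<and>
     fst u \<le> fst v \<and> fst v \<le> Suc (fst u) \<and> snd u \<le> snd v \<and> snd v \<le> Suc (snd u)}"

definition hex_adj :: "nat \<Rightarrow> ((nat \<times> nat) \<times> (nat \<times> nat)) set" where
  "hex_adj p = hex_arcs p \<union> (hex_arcs p)\<inverse>"

definition mono_adj :: "('h \<times> 'h) set \<Rightarrow> ('h \<Rightarrow> bool) \<Rightarrow> ('h \<times> 'h) set" where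
  "mono_adj E c = {(u, v) \<in> E. c u = c v}"

lemma sym_mono_adj: "sym E \<Longrightarrow> sym (mono_adj E c)"
  by (auto simp: mono_adj_def sym_def)

lemma sym_hex_adj: "sym (hex_adj p)"
  by (auto simp: hex_adj_def sym_def)

text \<open>A discrete intermediate value theorem: \<open>\<phi>\<close> falls by at most one per
  step, so a walk from \<open>u\<close> to \<open>v\<close> skips no value on its way down.\<close>

lemma component_intermediate_value:
  fixes \<phi> :: "'h \<Rightarrow> nat"
  assumes "(u, v) \<in> S\<^sup>*" and step: "\<And>a b. (a, b) \<in> S \<Longrightarrow> \<phi> a \<le> Suc (\<phi> b)"
    and "\<phi> v \<le> k" "k \<le> \<phi> u"
  shows "k \<in> \<phi> ` (S\<^sup>* `` {u})"
  using assms(1,3)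
proof (induction rule: rtrancl_induct)
  case base
  then have "k = \<phi> u" using assms(4) by simp
  then show ?case by auto
next
  case (step v w)
  have "(u, w) \<in> S\<^sup>*" using step by simp
  moreover have "\<phi> v \<le> Suc (\<phi> w)" using step assms(2) by blast
  ultimately show ?case using step
    by (cases "\<phi> v \<le> k") (auto intro!: image_eqI[of _ _ w])
qed

text \<open>The walk meets each of the \<open>p\<close> levels \<open>0..p-1\<close>. Level
  \<open>p - 1\<close> suffices for \<open>u\<close>; this slack of one is used when a triangle
  merely touches a far side.\<close>

lemma card_component_ge:
  fixes \<phi> :: "'h \<Rightarrow> nat"
  assumes "(u, v) \<in> S\<^sup>*" "\<And>a b. (a, b) \<in> S \<Longrightarrow> \<phi> a \<le> Suc (\<phi> b)"
    and "\<phi> v = 0" "p \<le> Suc (\<phi> u)" "finite (S\<^sup>* `` {u})"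
  shows "p \<le> card (S\<^sup>* `` {u})"
proof -
  have "{..<p} \<subseteq> \<phi> ` (S\<^sup>* `` {u})"
  proof
    fix k assume "k \<in> {..<p}"
    then show "k \<in> \<phi> ` (S\<^sup>* `` {u})"
      using assms(3,4) by (intro component_intermediate_value[OF assms(1,2)]) simp_all
  qed
  then have "card {..<p} \<le> card (S\<^sup>* `` {u})"
    using assms(5) by (meson card_image_le card_mono finite_imageI order_trans)
  then show ?thesis by simp
qed

text \<open>Kuhn's form of Sperner's lemma in dimension 2: the number of fully labelled simplices is
  odd, hence not zero. The reduced label of a point is the first index with a nonzero label, or 2 if
  there is none, which gives the conditions on \<open>a\<close>, \<open>b\<close> and
  \<open>d\<close>.\<close>

lemma kuhn_triangle:
  fixes lab :: "nat \<times> nat \<Rightarrow> nat \<Rightarrow> nat"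
  assumes "0 < p"
    and "\<And>u. u \<in> hex_verts p \<Longrightarrow> fst u = 0 \<Longrightarrow> lab u 0 = 0"
    and "\<And>u. u \<in> hex_verts p \<Longrightarrow> snd u = 0 \<Longrightarrow> lab u 1 = 0"
    and "\<And>u. u \<in> hex_verts p \<Longrightarrow> fst u = p \<Longrightarrow> lab u 0 = 1"
    and "\<And>u. u \<in> hex_verts p \<Longrightarrow> snd u = p \<Longrightarrow> lab u 1 = 1"
  obtains a b d where "{a, b, d} \<times> {a, b, d} \<subseteq> hex_adj p \<union> Id"
    and "a \<in> hex_verts p" "b \<in> hex_verts p" "d \<in> hex_verts p"
    and "lab a 0 \<noteq> 0" "lab b 0 = 0" "lab b 1 \<noteq> 0" "lab d 0 = 0" "lab d 1 = 0"
proof -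
  define L where "L f = lab (f 0, f 1)" for f :: "nat \<Rightarrow> nat"
  have less2: "j = 0 \<or> j = 1" if "j < 2" for j :: nat
    using that by auto
  have "odd (card {s. ksimplex p 2 s \<and> (reduced 2 \<circ> L) ` s = {..2}})"
  proof (rule kuhn_combinatorial)
    show "\<forall>x j. (\<forall>j. x j \<le> p) \<and> j < 2 \<and> x j = 0 \<longrightarrow> L x j = 0"
      using assms(2,3) less2 by (fastforce simp: L_def hex_verts_def)
    show "\<forall>x j. (\<forall>j. x j \<le> p) \<and> j < 2 \<and> x j = p \<longrightarrow> L x j = 1"
      using assms(4,5) less2 by (fastforce simp: L_def hex_verts_def)
  qed fact
  then obtain s where "ksimplex p 2 s" and s: "(reduced 2 \<circ> L) ` s = {..2}"
    by (metis (mono_tags, lifting) Collect_empty_eq card.empty even_zero)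
  then obtain u0 b0 where "kuhn_simplex p 2 b0 u0 s"
    by (auto elim: ksimplex.cases)
  then interpret kuhn_simplex p 2 b0 u0 s .
  obtain fa fb fd where f: "fa \<in> s" "fb \<in> s" "fd \<in> s"
    and red: "reduced 2 (L fa) = 0" "reduced 2 (L fb) = 1" "reduced 2 (L fd) = 2"
  proof -
    have "0 \<in> (reduced 2 \<circ> L) ` s" "1 \<in> (reduced 2 \<circ> L) ` s" "2 \<in> (reduced 2 \<circ> L) ` s"
      using s by auto
    then show ?thesis using that by fastforce
  qed
  define e where "e f = (f 0, f 1)" for f :: "nat \<Rightarrow> nat"
  have adj: "(e f, e g) \<in> hex_adj p \<union> Id" if "f \<in> s" "g \<in> s" for f g
  proof -
    have ordered: "(e f, e g) \<in> hex_adj p \<union> Id" if "f \<le> g" "f \<in> s" "g \<in> s" for f g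
    proof -
      \<comment> \<open>All points of a simplex lie in the unit cube above its base, so comparable
        ones differ by at most one in each coordinate.\<close>
      have "f j \<le> g j" "g j \<le> Suc (f j)" "f j \<le> p" "g j \<le> p" for j
        using that le_Suc_base[of g j] base_le[of f j] s_le_p[of _ j]
        by (auto simp: le_fun_def intro: order_trans)
      then show ?thesis
        by (auto simp: e_def hex_adj_def hex_arcs_def hex_verts_def)
    qed
    have "sym (hex_adj p \<union> Id)"
      using sym_hex_adj by (simp add: sym_Un sym_Id)
    then show ?thesis
      using chain[OF that] ordered that by (meson symD)
  qed
  have verts: "e f \<in> hex_verts p" if "f \<in> s" for f
    using that s_le_p by (auto simp: e_def hex_verts_def)
  show thesis
  proof (rule that)
    show "{e fa, e fb, e fd} \<times> {e fa, e fb, e fd} \<subseteq> hex_adj p \<union> Id"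
      using adj f by auto
    show "e fa \<in> hex_verts p" "e fb \<in> hex_verts p" "e fd \<in> hex_verts p"
      using verts f by auto
    show "lab (e fa) 0 \<noteq> 0"
      using reduced_labelling[of 2 "L fa"] red by (auto simp: L_def e_def)
    show "lab (e fb) 0 = 0" "lab (e fb) 1 \<noteq> 0"
      using reduced_labelling[of 2 "L fb"] red by (auto simp: L_def e_def)
    show "lab (e fd) 0 = 0" "lab (e fd) 1 = 0"
      using reduced_labelling[of 2 "L fd"] red by (auto simp: L_def e_def)
  qed
qed

text \<open>If all components had fewer than \<open>p\<close> vertices, none could join two opposite
  sides. Then a labelling exists that meets Kuhn's boundary conditions, and its fully labelled
  triangle exhibits a component that is too long.\<close>

lemma hex_lemma:
  assumes "0 < p"
  shows "\<exists>x\<in>hex_verts p. p \<le> card ((mono_adj (hex_adj p) c)\<^sup>* `` {x})"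
proof (rule ccontr)
  assume contra: "\<not> ?thesis"
  define S where "S = mono_adj (hex_adj p) c"
  define left where "left u \<longleftrightarrow> (\<exists>v. (u, v) \<in> S\<^sup>* \<and> fst v = 0)" for u
  define bottom where "bottom u \<longleftrightarrow> (\<exists>v. (u, v) \<in> S\<^sup>* \<and> snd v = 0)" for u
  have step: "fst a \<le> Suc (fst b)" "snd a \<le> Suc (snd b)" if "(a, b) \<in> S" for a b
    using that by (auto simp: S_def mono_adj_def hex_adj_def hex_arcs_def)
  have fin: "finite (S\<^sup>* `` {u})" for u
  proof -
    have "S \<subseteq> hex_verts p \<times> hex_verts p"
      by (auto simp: S_def mono_adj_def hex_adj_def hex_arcs_def)
    then have "S\<^sup>* `` {u} \<subseteq> insert u (hex_verts p)"
      by (auto elim: rtranclE)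
    then show ?thesis
      by (rule finite_subset) (simp add: hex_verts_def)
  qed
  have not_left: "\<not> left u" if "u \<in> hex_verts p" "p \<le> Suc (fst u)" for u
  proof
    assume "left u"
    then obtain w where "(u, w) \<in> S\<^sup>*" "fst w = 0"
      unfolding left_def by blast
    then have "p \<le> card (S\<^sup>* `` {u})"
      using step that fin by (intro card_component_ge[of u w S fst]) auto
    then show False
      using contra that S_def by blast
  qed
  have not_bottom: "\<not> bottom u" if "u \<in> hex_verts p" "p \<le> Suc (snd u)" for u
  proof
    assume "bottom u"
    then obtain w where "(u, w) \<in> S\<^sup>*" "snd w = 0"
      unfolding bottom_def by blast
    then have "p \<le> card (S\<^sup>* `` {u})"
      using step that fin by (intro card_component_ge[of u w S snd]) auto
    then show False
      using contra that S_def by blast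
  qed
  have same: "left u = left v" "bottom u = bottom v"
    if "c u = c v" "(u, v) \<in> hex_adj p \<union> Id" for u v
  proof -
    have "(u, v) \<in> S \<union> Id"
      using that by (auto simp: S_def mono_adj_def)
    moreover have "sym (S \<union> Id)"
      unfolding S_def by (intro sym_Un sym_Id sym_mono_adj sym_hex_adj)
    ultimately have "(u, v) \<in> S\<^sup>*" "(v, u) \<in> S\<^sup>*"
      by (auto dest: symD)
    then show "left u = left v" "bottom u = bottom v"
      unfolding left_def bottom_def using rtrancl_trans by metis+
  qed
  \<comment> \<open>Vertices of one colour inside a small triangle agree on \<open>left\<close> and \<open>bottom\<close>, so a triangle with
    all three labels can only occur at the far sides \<open>fst u = p\<close> and \<open>snd u = p\<close>, where
    \<open>left\<close> and \<open>bottom\<close> fail because no component is large.\<close>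
  define lab :: "nat \<times> nat \<Rightarrow> nat \<Rightarrow> nat" where
    "lab u j = (if j = 0 then if c u then of_bool (\<not> left u) else of_bool (fst u = p)
                else if c u then of_bool (snd u = p) else of_bool (\<not> bottom u))" for u j
  obtain a b d where adj: "{a, b, d} \<times> {a, b, d} \<subseteq> hex_adj p \<union> Id"
    and V: "a \<in> hex_verts p" "b \<in> hex_verts p" "d \<in> hex_verts p"
    and l: "lab a 0 \<noteq> 0" "lab b 0 = 0" "lab b 1 \<noteq> 0" "lab d 0 = 0" "lab d 1 = 0"
  proof (rule kuhn_triangle[OF assms, of lab])
    show "lab u 0 = 0" if "u \<in> hex_verts p" "fst u = 0" for u
      using that assms left_def[of u] by (auto simp: lab_def simp del: split_paired_Ex)
    show "lab u 1 = 0" if "u \<in> hex_verts p" "snd u = 0" for u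
      using that assms bottom_def[of u] by (auto simp: lab_def simp del: split_paired_Ex)
    show "lab u 0 = 1" if "u \<in> hex_verts p" "fst u = p" for u
      using that not_left by (auto simp: lab_def)
    show "lab u 1 = 1" if "u \<in> hex_verts p" "snd u = p" for u
      using that not_bottom by (auto simp: lab_def)
  qed
  \<comment> \<open>If \<open>c d\<close> holds, then \<open>d\<close> is joined to the left side,
    but \<open>a\<close> is not in its component, so the nonzero label of \<open>a\<close> comes
    from \<open>fst a = p\<close>. As \<open>d\<close> is at most one column away,
    \<open>not_left\<close> applies to it. The other case is the same with \<open>b\<close>,
    \<open>bottom\<close> and the second coordinate.\<close>
  have near: "fst a \<le> Suc (fst d)" "snd b \<le> Suc (snd d)"
    using adj by (auto simp: hex_adj_def hex_arcs_def)
  show False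
  proof (cases "c d")
    case True
    then have "left d" using l by (simp add: lab_def split: if_splits)
    moreover have "fst a = p"
      using l(1) True \<open>left d\<close> same(1)[of a d] adj by (auto simp: lab_def split: if_splits)
    ultimately show False using not_left[OF V(3)] near by simp
  next
    case False
    then have "bottom d" using l by (simp add: lab_def split: if_splits)
    moreover have "snd b = p"
      using l(3) False \<open>bottom d\<close> same(2)[of b d] adj by (auto simp: lab_def split: if_splits)
    ultimately show False using not_bottom[OF V(3)] near by simp
  qed
qed

section \<open>Homogeneous layouts of a star product\<close>

text \<open>Three leaves suffice; \<open>v i h\<close> is the copy of \<open>h\<close> at leaf \<open>i\<close>, \<open>\<rho> h\<close> the copy at the root, and
  \<open>cs h\<close> the common stack of the star edges at \<open>h\<close>.\<close>

locale homogeneous_star_layout =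
  fixes lt :: "'v \<Rightarrow> 'v \<Rightarrow> bool" and v :: "nat \<Rightarrow> 'h \<Rightarrow> 'v" and \<rho> :: "'h \<Rightarrow> 'v"
    and W :: "'h set" and E :: "('h \<times> 'h) set" and cs :: "'h \<Rightarrow> nat" and s :: nat
  assumes trans: "lt a b \<Longrightarrow> lt b c \<Longrightarrow> lt a c"
    and irrefl: "\<not> lt a a"
    and total_v: "h \<in> W \<Longrightarrow> h' \<in> W \<Longrightarrow> i < 3 \<Longrightarrow> j < 3 \<Longrightarrow> (i, h) \<noteq> (j, h') \<Longrightarrow>
      lt (v i h) (v j h') \<or> lt (v j h') (v i h)"
    and total_v_root: "h \<in> W \<Longrightarrow> h' \<in> W \<Longrightarrow> i < 3 \<Longrightarrow> lt (v i h) (\<rho> h') \<or> lt (\<rho> h') (v i h)"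
    and total_root: "h \<in> W \<Longrightarrow> h' \<in> W \<Longrightarrow> h \<noteq> h' \<Longrightarrow> lt (\<rho> h) (\<rho> h') \<or> lt (\<rho> h') (\<rho> h)"
    and finite_W: "finite W"
    and E: "E \<subseteq> W \<times> W" "sym E" "irrefl E"
    and homogeneous_between: "h \<in> W \<Longrightarrow> h' \<in> W \<Longrightarrow> i < j \<Longrightarrow> j < 3 \<Longrightarrow>
      lt (v i h) (v j h') \<longleftrightarrow> lt (v 0 h) (v 1 h')"
    and homogeneous_within: "h \<in> W \<Longrightarrow> h' \<in> W \<Longrightarrow> i < 3 \<Longrightarrow>
      lt (v i h) (v i h') \<longleftrightarrow> lt (v 0 h) (v 0 h')"
    and homogeneous_root: "h \<in> W \<Longrightarrow> i < 3 \<Longrightarrow> lt (v i h) (\<rho> h) \<longleftrightarrow> lt (v 0 h) (\<rho> h)"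
    and no_cross_copies: "(h, h') \<in> E \<Longrightarrow> i < 3 \<Longrightarrow> j < 3 \<Longrightarrow>
      lt (v i h) (v j h) \<Longrightarrow> lt (v j h) (v i h') \<Longrightarrow> lt (v i h') (v j h') \<Longrightarrow> False"
    and no_cross_star_right: "h \<in> W \<Longrightarrow> h' \<in> W \<Longrightarrow> i < 3 \<Longrightarrow> j < 3 \<Longrightarrow> i \<noteq> j \<Longrightarrow> cs h = cs h' \<Longrightarrow>
      lt (v i h) (v j h') \<Longrightarrow> lt (v j h') (\<rho> h) \<Longrightarrow> lt (\<rho> h) (\<rho> h') \<Longrightarrow> False"
    and no_cross_star_left: "h \<in> W \<Longrightarrow> h' \<in> W \<Longrightarrow> i < 3 \<Longrightarrow> j < 3 \<Longrightarrow> i \<noteq> j \<Longrightarrow> cs h = cs h' \<Longrightarrow>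
      lt (\<rho> h) (\<rho> h') \<Longrightarrow> lt (\<rho> h') (v i h) \<Longrightarrow> lt (v i h) (v j h') \<Longrightarrow> False"
    and cs: "h \<in> W \<Longrightarrow> cs h \<in> {1..s}"
begin

text \<open>Reversal exchanges the two conditions on star edges and preserves the one on copies by
  symmetry of \<open>E\<close>. It reduces decreasing vertices to increasing ones.\<close>

lemma reversed: "homogeneous_star_layout (\<lambda>a b. lt b a) v \<rho> W E cs s"
proof
  have asym: "\<not> lt b a" if "lt a b" for a b
    using that trans irrefl by blast
  have neg: "lt (v j h') (v i h) \<longleftrightarrow> \<not> lt (v i h) (v j h')"
    if "h \<in> W" "h' \<in> W" "i < 3" "j < 3" "(i, h) \<noteq> (j, h')" for i j h h'
    using total_v[OF that] asym by blast
  show "lt (v j h') (v i h) \<longleftrightarrow> lt (v 1 h') (v 0 h)"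
    if "h \<in> W" "h' \<in> W" "i < j" "j < 3" for h h' i j
    using that neg[of h h' i j] neg[of h h' 0 1] homogeneous_between[OF that] by auto
  show "lt (\<rho> h) (v i h) \<longleftrightarrow> lt (\<rho> h) (v 0 h)" if "h \<in> W" "i < 3" for h i
    using homogeneous_root[OF that] total_v_root[of h h i] total_v_root[of h h 0] that asym
    by auto
  show "False" if "(h, h') \<in> E" "i < 3" "j < 3"
    "lt (v j h) (v i h)" "lt (v i h') (v j h)" "lt (v j h') (v i h')" for h h' i j
    using that no_cross_copies[OF symD[OF E(2)]] by blast
  show "lt (v i h') (v i h) \<longleftrightarrow> lt (v 0 h') (v 0 h)" if "h \<in> W" "h' \<in> W" "i < 3" for h h' i
    using that homogeneous_within by blast
  show "lt c a" if "lt b a" "lt c b" for a b c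
    using that trans by blast
  show "lt (v j h') (v i h) \<or> lt (v i h) (v j h')"
    if "h \<in> W" "h' \<in> W" "i < 3" "j < 3" "(i, h) \<noteq> (j, h')" for h h' i j
    using total_v[OF that] by blast
  show "lt (\<rho> h') (v i h) \<or> lt (v i h) (\<rho> h')" if "h \<in> W" "h' \<in> W" "i < 3" for h h' i
    using total_v_root[OF that] by blast
  show "lt (\<rho> h') (\<rho> h) \<or> lt (\<rho> h) (\<rho> h')" if "h \<in> W" "h' \<in> W" "h \<noteq> h'" for h h'
    using total_root[OF that] by blast
  show False
    if "h \<in> W" "h' \<in> W" "i < 3" "j < 3" "i \<noteq> j" "cs h = cs h'"
      "lt (v j h') (v i h)" "lt (\<rho> h) (v j h')" "lt (\<rho> h') (\<rho> h)" for h h' i j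
    using no_cross_star_left[of h' h j i] that by simp
  show False
    if "h \<in> W" "h' \<in> W" "i < 3" "j < 3" "i \<noteq> j" "cs h = cs h'"
      "lt (\<rho> h') (\<rho> h)" "lt (v i h) (\<rho> h')" "lt (v j h') (v i h)" for h h' i j
    using no_cross_star_right[of h' h j i] that by simp
qed (fact irrefl finite_W E cs)+

text \<open>This uses the third leaf: \<open>h\<close> at leaf 0 precedes \<open>h'\<close> at leaf
  1, which precedes \<open>h''\<close> at leaf 2, and homogeneity turns the pair of leaves 0, 2 back
  into 0, 1.\<close>

lemma between_trans:
  assumes "h \<in> W" "h' \<in> W" "h'' \<in> W"
    and "lt (v 0 h) (v 1 h')" "lt (v 0 h') (v 1 h'')"
  shows "lt (v 0 h) (v 1 h'')"
proof -
  have "lt (v 1 h') (v 2 h'')"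
    using assms homogeneous_between[of h' h'' 1 2] by simp
  then have "lt (v 0 h) (v 2 h'')"
    using assms trans by blast
  then show ?thesis
    using assms homogeneous_between[of h h'' 0 2] by simp
qed

text \<open>Otherwise the order is \<open>v 0 h'\<close>, \<open>v 1 h'\<close>,
  \<open>v 0 h\<close>, \<open>v 1 h\<close>, and the two copies of the edge at leaves 0 and 1
  cross.\<close>

lemma between_adjacent:
  assumes hE: "(h, h') \<in> E" and inc: "lt (v 0 h) (v 1 h)" "lt (v 0 h') (v 1 h')"
  shows "lt (v 0 h) (v 1 h')"
proof (rule ccontr)
  assume neg: "\<not> ?thesis"
  have W: "h \<in> W" "h' \<in> W" "h \<noteq> h'"
    using hE E by (auto simp: irrefl_def)
  have a: "lt (v 1 h') (v 0 h)"
    using total_v[of h h' 0 1] W neg by simp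
  have "lt (v 0 h') (v 0 h)"
    using inc(2) a by (rule trans)
  then have "lt (v 1 h') (v 1 h)"
    using homogeneous_within[of h' h 1] W by simp
  then show False
    using no_cross_copies[OF symD[OF E(2) hE], of 0 1] a inc by simp
qed

text \<open>In the component, every copy at an earlier leaf precedes every copy at a later one.
  There are \<open>2 * s\<close> pairs of a stack and a side of the root, so in a larger component
  two vertices share both, and two of their star edges cross.\<close>

lemma increasing_component_le:
  assumes x: "x \<in> W" "lt (v 0 x) (v 1 x)"
  shows "card ((mono_adj E (\<lambda>h. lt (v 0 h) (v 1 h)))\<^sup>* `` {x}) \<le> 2 * s"
proof (rule ccontr)
  define inc where "inc h \<longleftrightarrow> lt (v 0 h) (v 1 h)" for h
  define S where "S = mono_adj E inc"
  define C where "C = S\<^sup>* `` {x}"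
  assume "\<not> ?thesis"
  then have big: "2 * s < card C"
    by (simp add: C_def S_def inc_def[abs_def])
  have path: "h' \<in> W \<and> inc h' \<and> lt (v 0 h) (v 1 h')" if "(h, h') \<in> S\<^sup>*" "h \<in> W" "inc h" for h h'
    using that
  proof (induction rule: rtrancl_induct)
    case (step y z)
    then have "(y, z) \<in> E" "inc z" "z \<in> W" "y \<in> W" "inc y"
      using E by (auto simp: S_def mono_adj_def)
    then show ?case
      using between_adjacent[of y z] between_trans[of h y z] step by (auto simp: inc_def)
  qed (auto simp: inc_def)
  have CW: "C \<subseteq> W" and Cinc: "\<And>h. h \<in> C \<Longrightarrow> inc h"
    using path x by (auto simp: C_def inc_def)
  have between: "lt (v i h) (v j h')" if "h \<in> C" "h' \<in> C" "i < j" "j < 3" for h h' i j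
  proof -
    have "sym (S\<^sup>*)"
      unfolding S_def by (intro sym_rtrancl sym_mono_adj E)
    then have "(h, x) \<in> S\<^sup>*" "(x, h') \<in> S\<^sup>*"
      using that by (auto simp: C_def dest: symD)
    then have "(h, h') \<in> S\<^sup>*"
      by (rule rtrancl_trans)
    then have "lt (v 0 h) (v 1 h')"
      using path that CW Cinc by blast
    then show ?thesis
      using that CW homogeneous_between by blast
  qed
  define T where "T h \<longleftrightarrow> lt (v 0 h) (\<rho> h)" for h
  have "\<not> inj_on (\<lambda>h. (cs h, T h)) C"
  proof
    assume "inj_on (\<lambda>h. (cs h, T h)) C"
    moreover have "(\<lambda>h. (cs h, T h)) ` C \<subseteq> {1..s} \<times> UNIV"
      using cs CW by auto
    ultimately have "card C \<le> card ({1..s} \<times> (UNIV :: bool set))"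
      by (intro card_inj_on_le) auto
    then show False using big by (simp add: card_cartesian_product)
  qed
  then obtain a b where ab: "a \<in> C" "b \<in> C" "a \<noteq> b" "cs a = cs b" "T a = T b"
    unfolding inj_on_def by blast
  then have "lt (\<rho> a) (\<rho> b) \<or> lt (\<rho> b) (\<rho> a)"
    using total_root CW by blast
  then obtain h h' where h: "h \<in> C" "h' \<in> C" "cs h = cs h'" "T h = T h'" "lt (\<rho> h) (\<rho> h')"
    using ab by metis
  have W: "h \<in> W" "h' \<in> W" using h CW by auto
  show False
  proof (cases "T h")
    \<comment> \<open>Roots to the right: \<open>v 1 h'\<close> precedes \<open>v 2 h\<close> and
      hence \<open>\<rho> h\<close>, so the crossing order is \<open>v 0 h\<close>,
      \<open>v 1 h'\<close>, \<open>\<rho> h\<close>, \<open>\<rho> h'\<close>.\<close>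
    case True
    then have "lt (v 2 h) (\<rho> h)"
      using homogeneous_root[of h 2] W by (simp add: T_def)
    then have "lt (v 1 h') (\<rho> h)"
      using between[of h' h 1 2] h trans[of "v 1 h'" "v 2 h"] by simp
    then show False
      using no_cross_star_right[of h h' 0 1] between[of h h' 0 1] h W by auto
  next
    \<comment> \<open>Roots to the left: \<open>\<rho> h'\<close> precedes \<open>v 0 h'\<close> and
      hence \<open>v 1 h\<close>, so the crossing order is \<open>\<rho> h\<close>,
      \<open>\<rho> h'\<close>, \<open>v 1 h\<close>, \<open>v 2 h'\<close>.\<close>
    case False
    then have "lt (\<rho> h') (v 0 h')"
      using total_v_root[of h' h' 0] W h by (auto simp: T_def)
    then have "lt (\<rho> h') (v 1 h)"
      using between[of h' h 0 1] h trans[of "\<rho> h'" "v 0 h'"] by simp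
    then show False
      using no_cross_star_left[of h h' 1 2] between[of h h' 1 2] h W by auto
  qed
qed

text \<open>The colouring is the direction in which the copies of a vertex move with the leaf; a
  decreasing component is increasing for the reversed order.\<close>

lemma small_component:
  "\<exists>c. \<forall>x\<in>W. card ((mono_adj E c)\<^sup>* `` {x}) \<le> 2 * s"
proof (intro exI ballI)
  fix x assume x: "x \<in> W"
  define inc where "inc h \<longleftrightarrow> lt (v 0 h) (v 1 h)" for h
  show "card ((mono_adj E inc)\<^sup>* `` {x}) \<le> 2 * s"
  proof (cases "inc x")
    case True
    then show ?thesis
      using increasing_component_le[of x] x by (simp add: inc_def[abs_def])
  next
    case False
    interpret rev: homogeneous_star_layout "\<lambda>a b. lt b a" v \<rho> W E cs s
      by (rule reversed)
    have dec: "lt (v 1 h) (v 0 h) \<longleftrightarrow> \<not> inc h" if "h \<in> W" for h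
      using total_v[of h h 0 1] that trans[of "v 0 h" "v 1 h" "v 0 h"] irrefl[of "v 0 h"]
      unfolding inc_def by auto
    have "mono_adj E inc = mono_adj E (\<lambda>h. lt (v 1 h) (v 0 h))"
      using E(1) dec by (auto simp: mono_adj_def)
    then show ?thesis
      using rev.increasing_component_le[of x] x False dec by simp
  qed
qed

end

section \<open>Subdivisions with few stacks\<close>

text \<open>For monotone \<open>f c\<close>, no two edges of class \<open>c\<close> are strictly
  nested in the natural order, so each class is a queue.\<close>

definition queue_graph :: "nat \<Rightarrow> nat \<Rightarrow> (nat \<Rightarrow> nat \<Rightarrow> nat) \<Rightarrow> nat ugraph" where
  "queue_graph q N f =
     \<lparr>verts = {..<N}, edges = {{f c t, t} | c t. c < q \<and> t < N \<and> f c t < t}\<rparr>"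

lemma fin_simple_queue_graph: "fin_simple_graph (queue_graph q N f)"
  by (auto simp: fin_simple_graph_def queue_graph_def card_insert_if)

lemma queue_graph_edgeI: "c < q \<Longrightarrow> t < N \<Longrightarrow> f c t = u \<Longrightarrow> u < t \<Longrightarrow> {u, t} \<in> edges (queue_graph q N f)"
  by (auto simp: queue_graph_def)

text \<open>Each class gets two stacks, one for the halves at the smaller endpoints and one for
  those at the larger. Monotonicity makes both endpoints weakly increase with \<open>Max e\<close>,
  while the subdivision vertices run in reverse, so the halves in one stack do not cross.\<close>

lemma queue_graph_subdivision:
  assumes mono: "\<And>c. c < q \<Longrightarrow> mono (f c)"
  obtains G' r \<phi> where "le_subdivision 1 (queue_graph q N f) G'" "stack_layout (2 * q) G' r \<phi>"
proof -
  define G where "G = queue_graph q N f"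
  \<comment> \<open>An edge may arise from several classes; the least one is chosen.\<close>
  define cl where "cl e = (LEAST c. c < q \<and> f c (Max e) = Min e)" for e :: "nat set"
  \<comment> \<open>The subdivision vertices of class \<open>c\<close> fill the block \<open>{Suc c * N..<Suc (Suc c) * N}\<close> in reverse.\<close>
  define d where "d e = Suc (cl e) * N + (N - 1 - Max e)" for e :: "nat set"
  define P where "P e = [Min e, d e, Max e]" for e :: "nat set"
  have E: "Min e < Max e \<and> Max e < N \<and> cl e < q \<and> f (cl e) (Max e) = Min e"
    if e0: "e \<in> edges G" for e
  proof -
    obtain c t where e: "e = {f c t, t}" "c < q" "t < N" "f c t < t"
      using e0 by (auto simp: G_def queue_graph_def)
    then have M: "Min e = f c t" "Max e = t" by auto
    have "cl e < q \<and> f (cl e) (Max e) = Min e"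
      unfolding cl_def by (rule LeastI[of _ c]) (use e M in auto)
    then show ?thesis using e M by auto
  qed
  have E_eq: "{Min e, Max e} = e" if e0: "e \<in> edges G" for e
    using e0 by (auto simp: G_def queue_graph_def)
  have d_div: "d e div N = Suc (cl e)" and d_mod: "d e mod N = N - 1 - Max e" and d_ge: "N \<le> d e"
    if "e \<in> edges G" for e
  proof -
    have "N - 1 - Max e < N" using E[OF that] by simp
    moreover have "d e = (N - 1 - Max e) + N * Suc (cl e)"
      by (simp add: d_def)
    ultimately show "d e div N = Suc (cl e)" "d e mod N = N - 1 - Max e"
      by (simp_all only: div_mult_self2 mod_mult_self2 div_less mod_less)
    show "N \<le> d e" unfolding d_def by simp
  qed
  have d_inj: "e = e'" if "e \<in> edges G" "e' \<in> edges G" "d e = d e'" for e e'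
  proof -
    have "cl e = cl e'" "N - 1 - Max e = N - 1 - Max e'"
      using d_div d_mod that by (metis Suc_inject)+
    then have "cl e = cl e'" "Max e = Max e'"
      using E[OF that(1)] E[OF that(2)] by linarith+
    then show ?thesis
      using E[OF that(1)] E[OF that(2)] E_eq[OF that(1)] E_eq[OF that(2)] by metis
  qed
  have internal: "internal_verts (P e) = {d e}" for e
    by (simp add: internal_verts_def P_def)
  define G' where "G' = \<lparr>verts = verts G \<union> d ` edges G, edges = (\<Union>e\<in>edges G. path_edges (P e))\<rparr>"
  have "subdivides_via P G G'"
    unfolding subdivides_via_def internal
  proof (intro conjI ballI impI)
    fix e assume e: "e \<in> edges G"
    show "distinct (P e)" using E[OF e] d_ge[OF e] by (simp add: P_def)
    show "2 \<le> length (P e)" by (simp add: P_def)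
    show "{hd (P e), last (P e)} = e" using E_eq[OF e] by (simp add: P_def)
    show "{d e} \<inter> verts G = {}" using d_ge[OF e] by (simp add: G_def queue_graph_def)
  next
    fix e e' assume "e \<in> edges G" "e' \<in> edges G" "e \<noteq> e'"
    then show "{d e} \<inter> {d e'} = {}" using d_inj by auto
  next
    show "verts G' = verts G \<union> (\<Union>e\<in>edges G. {d e})" by (auto simp: G'_def)
    show "edges G' = (\<Union>e\<in>edges G. path_edges (P e))" by (simp add: G'_def)
  qed
  then have sub: "le_subdivision 1 G G'"
    unfolding le_subdivision_def by (intro exI[of _ P]) (simp add: internal)
  have path: "path_edges (P e) = {{Min e, d e}, {Max e, d e}}" for e
  proof -
    have "path_edges (P e) = (\<lambda>i. {P e ! i, P e ! Suc i}) ` {i. Suc i < length (P e)}"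
      unfolding path_edges_def by blast
    also have "{i. Suc i < length (P e)} = {0, 1}"
      by (auto simp: P_def)
    finally show ?thesis
      by (simp add: P_def insert_commute)
  qed
  define r where "r = {(u, v) \<in> verts G' \<times> verts G'. u < v}"
  \<comment> \<open>For a half \<open>{v, d e}\<close> the larger end \<open>d e\<close> encodes
    \<open>cl e\<close> as quotient and \<open>Max e\<close> through the remainder. The subtracted
    bit tells whether \<open>v = Max e\<close>, so class \<open>c\<close> uses the stacks
    \<open>2 * c + 1\<close> and \<open>2 * c + 2\<close>.\<close>
  define \<phi> where "\<phi> e = 2 * (Max e div N) - of_bool (Min e = N - 1 - Max e mod N)" for e :: "nat set"
  have lower: "\<exists>e\<in>edges G. w = d e \<and> (v = Min e \<or> v = Max e) \<and> v < N \<and>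
      \<phi> {v, w} = 2 * Suc (cl e) - of_bool (v = Max e)"
    if vw: "{v, w} \<in> edges G'" "v < w" for v w
  proof -
    obtain e where e: "e \<in> edges G" "{v, w} = {Min e, d e} \<or> {v, w} = {Max e, d e}"
      using vw(1) by (auto simp: G'_def path)
    have *: "w = d e \<and> (v = Min e \<or> v = Max e) \<and> v < N"
      using e(2) E[OF e(1)] d_ge[OF e(1)] vw(2) by (auto simp: doubleton_eq_iff)
    have "Max {v, w} = d e" "Min {v, w} = v"
      using * vw(2) by auto
    then have "\<phi> {v, w} = 2 * Suc (cl e) - of_bool (v = Max e)"
      using d_div[OF e(1)] d_mod[OF e(1)] E[OF e(1)] by (simp add: \<phi>_def)
    then show ?thesis using * e(1) by blast
  qed
  have no_cross: False
    if vw: "{v, w} \<in> edges G'" and xy: "{x, y} \<in> edges G'" and "\<phi> {v, w} = \<phi> {x, y}"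
      and o: "v < x" "x < w" "w < y" for v w x y
  proof -
    obtain e where e: "e \<in> edges G" "w = d e" "v = Min e \<or> v = Max e"
        "\<phi> {v, w} = 2 * Suc (cl e) - of_bool (v = Max e)"
      using lower[OF vw] o by auto
    obtain e' where e': "e' \<in> edges G" "y = d e'" "x = Min e' \<or> x = Max e'"
        "\<phi> {x, y} = 2 * Suc (cl e') - of_bool (x = Max e')"
      using lower[OF xy] o by auto
    have "2 * Suc (cl e) - of_bool (v = Max e) = 2 * Suc (cl e') - of_bool (x = Max e')"
      using that(3) unfolding e(4) e'(4) .
    moreover have "a = b \<and> A = B" if "2 * Suc a - of_bool A = 2 * Suc b - of_bool B" for a b A B
      using that by (cases A; cases B) (simp_all, presburger+)
    ultimately have same: "cl e = cl e'" "v = Max e \<longleftrightarrow> x = Max e'"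
      by blast+
    \<comment> \<open>Within a block the order is reversed, so \<open>w < y\<close> puts
      \<open>Max e'\<close> below \<open>Max e\<close>; this contradicts \<open>v < x\<close> for
      either kind of half.\<close>
    then have "N - 1 - Max e < N - 1 - Max e'"
      using o(3) e(2) e'(2) by (simp add: d_def)
    then have less: "Max e' < Max e"
      by simp
    then have "Min e' \<le> Min e"
      using E[OF e(1)] E[OF e'(1)] same(1) mono[of "cl e"] by (metis less_imp_le monoD)
    then show False
      using less same(2) e(3) e'(3) o(1) by auto
  qed
  have "stack_layout (2 * q) G' r \<phi>"
    unfolding stack_layout_def
  proof (intro conjI ballI allI impI)
    show "r \<subseteq> verts G' \<times> verts G'" by (auto simp: r_def)
    show "strict_linear_order_on (verts G') r"
      unfolding strict_linear_order_on_def r_def trans_def irrefl_def total_on_def by auto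
  next
    fix e assume e: "e \<in> edges G'"
    then obtain v w where vw: "e = {v, w}" "v < w"
      using E d_ge by (fastforce simp: G'_def path)
    then obtain e0 where "e0 \<in> edges G" "\<phi> e = 2 * Suc (cl e0) - of_bool (v = Max e0)"
      using lower e by blast
    then show "\<phi> e \<in> {1..2 * q}"
      using E[of e0] by auto
  next
    fix v w x y
    assume "{v, w} \<in> edges G'" "{x, y} \<in> edges G'" "\<phi> {v, w} = \<phi> {x, y}"
    then show "\<not> cross r v w x y"
      using no_cross[of v w x y] no_cross[of x y v w] by (auto simp: cross_def r_def)
  qed
  then show thesis
    using that sub G_def by blast
qed

section \<open>Large star products need many stacks\<close>

lemma stack_layout_no_cross:
  assumes L: "stack_layout k G r \<phi>"
    and e: "{a, c} \<in> edges G" "{b, d} \<in> edges G" "\<phi> {a, c} = \<phi> {b, d}"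
    and o: "(a, b) \<in> r" "(b, c) \<in> r" "(c, d) \<in> r"
  shows False
proof -
  have t: "trans r" and i: "irrefl r"
    using L by (auto simp: stack_layout_def strict_linear_order_on_def)
  have ac: "(a, c) \<in> r" and bd: "(b, d) \<in> r" and ad: "(a, d) \<in> r"
    using o t by (meson transD)+
  then have "{a, c} \<inter> {b, d} = {}"
    using o i by (auto simp: irrefl_def)
  moreover have "cross r a c b d"
    using o by (simp add: cross_def)
  ultimately show False
    using L e ac bd unfolding stack_layout_def by blast
qed

text \<open>Containment allows a host graph with further edges. Index 0 is the centre of the star
  and \<open>1..a\<close> are its leaves.\<close>

definition contains_star_product ::
    "nat \<Rightarrow> 'h set \<Rightarrow> ('h \<times> 'h) set \<Rightarrow> (nat \<Rightarrow> 'h \<Rightarrow> 'v) \<Rightarrow> 'v ugraph \<Rightarrow> bool" where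
  "contains_star_product a W E g G \<longleftrightarrow>
     inj_on (\<lambda>(i, h). g i h) ({..a} \<times> W) \<and>
     (\<forall>i\<le>a. \<forall>h\<in>W. g i h \<in> verts G) \<and>
     (\<forall>i\<in>{1..a}. \<forall>(h, h')\<in>E. {g i h, g i h'} \<in> edges G) \<and>
     (\<forall>i\<in>{1..a}. \<forall>h\<in>W. {g 0 h, g i h} \<in> edges G)"

text \<open>A pair of leaves is coloured by all order and stack data that the homogeneous layout
  speaks of. On leaves that are alike by Ramsey's theorem, \<open>small_component\<close>
  contradicts \<open>big\<close>.\<close>

lemma star_product_no_stack_layout:
  fixes W :: "'h set" and E :: "('h \<times> 'h) set"
  assumes W: "finite W" and E: "E \<subseteq> W \<times> W" "sym E" "irrefl E"
    and big: "\<And>c. \<exists>x\<in>W. 2 * s < card ((mono_adj E c)\<^sup>* `` {x})"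
  shows "\<exists>a. \<forall>(G :: 'v ugraph) g r \<phi>.
    contains_star_product a W E g G \<longrightarrow> \<not> stack_layout s G r \<phi>"
proof -
  \<comment> \<open>Stack assignments are stored as graphs of functions, which keeps the set of
    colours finite.\<close>
  define K where "K = Pow (W \<times> W) \<times> Pow (W \<times> W) \<times> Pow W \<times> Pow (W \<times> {1..s}) \<times> Pow (E \<times> {1..s})"
  have "finite E"
    using E(1) W finite_subset by blast
  then have "finite K"
    using W by (simp add: K_def)
  \<comment> \<open>Four leaves are requested to get three: data on a single leaf is recorded for
    the earlier leaf of a pair, so leaf 2 needs a later partner.\<close>
  then obtain a where ramsey: "\<forall>f. (\<forall>i j :: nat. i < j \<longrightarrow> j < a \<longrightarrow> f i j \<in> K) \<longrightarrow>
      (\<exists>l c. \<forall>i j :: nat. i < j \<longrightarrow> j < 4 \<longrightarrow> l i < l j \<and> l j < a \<and> f (l i) (l j) = c)"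
    using ramsey_pairs[of K 4] by blast
  show ?thesis
  proof (intro exI[of _ a] allI impI notI)
    fix G :: "'v ugraph" and g r \<phi>
    assume "contains_star_product a W E g G" and L: "stack_layout s G r \<phi>"
    then have inj: "inj_on (\<lambda>(i, h). g i h) ({..a} \<times> W)"
      and gV: "\<And>i h. i \<le> a \<Longrightarrow> h \<in> W \<Longrightarrow> g i h \<in> verts G"
      and copy: "\<And>i h h'. 1 \<le> i \<Longrightarrow> i \<le> a \<Longrightarrow> (h, h') \<in> E \<Longrightarrow> {g i h, g i h'} \<in> edges G"
      and star: "\<And>i h. 1 \<le> i \<Longrightarrow> i \<le> a \<Longrightarrow> h \<in> W \<Longrightarrow> {g 0 h, g i h} \<in> edges G"
      unfolding contains_star_product_def by auto
    have ord: "trans r" "irrefl r" "total_on (verts G) r"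
      and col: "\<And>e. e \<in> edges G \<Longrightarrow> \<phi> e \<in> {1..s}"
      using L by (auto simp: stack_layout_def strict_linear_order_on_def)
    have total: "(g i h, g j h') \<in> r \<or> (g j h', g i h) \<in> r"
      if "i \<le> a" "j \<le> a" "h \<in> W" "h' \<in> W" "(i, h) \<noteq> (j, h')" for i j h h'
    proof -
      have "g i h \<noteq> g j h'"
        using inj_onD[OF inj, of "(i, h)" "(j, h')"] that by auto
      then show ?thesis
        using ord(3) gV that unfolding total_on_def by blast
    qed
    define between where "between i j = {(h, h') \<in> W \<times> W. (g (Suc i) h, g (Suc j) h') \<in> r}" for i j
    define inside where "inside i = {(h, h') \<in> W \<times> W. (g (Suc i) h, g (Suc i) h') \<in> r}" for i
    define below where "below i = {h \<in> W. (g (Suc i) h, g 0 h) \<in> r}" for i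
    define cstar where "cstar i = (\<lambda>h. (h, \<phi> {g 0 h, g (Suc i) h})) ` W" for i
    define ccopy where "ccopy i = (\<lambda>(h, h'). ((h, h'), \<phi> {g (Suc i) h, g (Suc i) h'})) ` E" for i
    have "(between i j, inside i, below i, cstar i, ccopy i) \<in> K" if "i < j" "j < a" for i j
    proof -
      have "cstar i \<subseteq> W \<times> {1..s}"
        unfolding cstar_def using col star[of "Suc i"] that by fastforce
      moreover have "ccopy i \<subseteq> E \<times> {1..s}"
        unfolding ccopy_def using col copy[of "Suc i"] that by fastforce
      ultimately show ?thesis
        by (auto simp: K_def between_def inside_def below_def)
    qed
    then have "\<exists>l c. \<forall>i j :: nat. i < j \<longrightarrow> j < 4 \<longrightarrow> l i < l j \<and> l j < a \<and>
        (between (l i) (l j), inside (l i), below (l i), cstar (l i), ccopy (l i)) = c"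
      by (intro ramsey[rule_format]) simp
    then obtain l c where l: "\<And>i j :: nat. i < j \<Longrightarrow> j < 4 \<Longrightarrow> l i < l j \<and> l j < a \<and>
        (between (l i) (l j), inside (l i), below (l i), cstar (l i), ccopy (l i)) = c"
      by blast
    have la: "Suc (l i) \<le> a" if "i < 3" for i
      using l[of i 3] that by simp
    have l_inj: "l i = l j \<longleftrightarrow> i = j" if "i < 3" "j < 3" for i j
      using l[of i j] l[of j i] that by (cases i j rule: linorder_cases) auto
    have same: "(between (l i) (l j), inside (l i), below (l i), cstar (l i), ccopy (l i)) =
        (between (l 0) (l 1), inside (l 0), below (l 0), cstar (l 0), ccopy (l 0))"
      if "i < j" "j < 4" for i j
      by (rule trans[OF _ sym]) (use l[of i j] l[of 0 1] that in simp_all)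
    have hom_between: "between (l i) (l j) = between (l 0) (l 1)" if "i < j" "j < 3" for i j
      using same[of i j] that by simp
    have hom: "inside (l i) = inside (l 0)" "below (l i) = below (l 0)"
        "cstar (l i) = cstar (l 0)" "ccopy (l i) = ccopy (l 0)" if "i < 3" for i
      using same[of i 3] that by simp_all
    define v where "v i = g (Suc (l i))" for i
    have mem: "(v i h, v j h') \<in> r \<longleftrightarrow> (h, h') \<in> between (l i) (l j)"
        "(v i h, v i h') \<in> r \<longleftrightarrow> (h, h') \<in> inside (l i)"
        "(v i h, g 0 h) \<in> r \<longleftrightarrow> h \<in> below (l i)" if "h \<in> W" "h' \<in> W" for i j h h'
      using that by (auto simp: v_def between_def inside_def below_def)
    have cs: "\<phi> {g 0 h, v i h} = \<phi> {g 0 h, v 0 h}" if "h \<in> W" "i < 3" for h i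
      using hom(3)[OF that(2)] that(1) unfolding cstar_def v_def by blast
    have cc: "\<phi> {v i h, v i h'} = \<phi> {v 0 h, v 0 h'}" if "(h, h') \<in> E" "i < 3" for h h' i
    proof -
      have "((h, h'), \<phi> {v i h, v i h'}) \<in> ccopy (l i)"
        unfolding ccopy_def v_def using that(1) by (rule rev_image_eqI) simp
      then show ?thesis
        unfolding hom(4)[OF that(2)] by (auto simp: ccopy_def v_def)
    qed
    have copy_edge: "{v i h, v i h'} \<in> edges G" if "(h, h') \<in> E" "i < 3" for h h' i
      using copy la that unfolding v_def by simp
    have star_edge: "{g 0 h, v i h} \<in> edges G" if "h \<in> W" "i < 3" for h i
      using star la that unfolding v_def by simp
    interpret homogeneous_star_layout "\<lambda>a b. (a, b) \<in> r" v "g 0" W E "\<lambda>h. \<phi> {g 0 h, v 0 h}" s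
    proof
      show "(x, z) \<in> r" if "(x, y) \<in> r" "(y, z) \<in> r" for x y z
        using ord(1) that by (rule transD)
      show "(x, x) \<notin> r" for x
        using ord(2) by (simp add: irrefl_def)
      show "(v i h, v j h') \<in> r \<or> (v j h', v i h) \<in> r"
        if "h \<in> W" "h' \<in> W" "i < 3" "j < 3" "(i, h) \<noteq> (j, h')" for h h' i j
        unfolding v_def using that la l_inj by (intro total) auto
      show "(v i h, g 0 h') \<in> r \<or> (g 0 h', v i h) \<in> r"
        if "h \<in> W" "h' \<in> W" "i < 3" for h h' i
        unfolding v_def using that la by (intro total) auto
      show "(g 0 h, g 0 h') \<in> r \<or> (g 0 h', g 0 h) \<in> r"
        if "h \<in> W" "h' \<in> W" "h \<noteq> h'" for h h'
        using that by (intro total) auto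
      show "(v i h, v j h') \<in> r \<longleftrightarrow> (v 0 h, v 1 h') \<in> r"
        if "h \<in> W" "h' \<in> W" "i < j" "j < 3" for h h' i j
        unfolding mem(1)[OF that(1,2)] hom_between[OF that(3,4)] by simp
      show "(v i h, v i h') \<in> r \<longleftrightarrow> (v 0 h, v 0 h') \<in> r"
        if "h \<in> W" "h' \<in> W" "i < 3" for h h' i
        unfolding mem(2)[OF that(1,2)] hom(1)[OF that(3)] by simp
      show "(v i h, g 0 h) \<in> r \<longleftrightarrow> (v 0 h, g 0 h) \<in> r" if "h \<in> W" "i < 3" for h i
        unfolding mem(3)[OF that(1,1)] hom(2)[OF that(2)] by simp
      show False if "(h, h') \<in> E" "i < 3" "j < 3"
        "(v i h, v j h) \<in> r" "(v j h, v i h') \<in> r" "(v i h', v j h') \<in> r" for h h' i j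
        using stack_layout_no_cross[OF L copy_edge[OF that(1,2)] copy_edge[OF that(1,3)] _ that(4-6)]
          cc[OF that(1,2)] cc[OF that(1,3)] by simp
      show False if "h \<in> W" "h' \<in> W" "i < 3" "j < 3" "\<phi> {g 0 h, v 0 h} = \<phi> {g 0 h', v 0 h'}"
        "(v i h, v j h') \<in> r" "(v j h', g 0 h) \<in> r" "(g 0 h, g 0 h') \<in> r" for h h' i j
        using stack_layout_no_cross[OF L _ _ _ that(6-8)] star_edge[OF that(1,3)]
          star_edge[OF that(2,4)] cs[OF that(1,3)] cs[OF that(2,4)] that(5)
        by (simp add: insert_commute)
      show False if "h \<in> W" "h' \<in> W" "i < 3" "j < 3" "\<phi> {g 0 h, v 0 h} = \<phi> {g 0 h', v 0 h'}"
        "(g 0 h, g 0 h') \<in> r" "(g 0 h', v i h) \<in> r" "(v i h, v j h') \<in> r" for h h' i j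
        using stack_layout_no_cross[OF L _ _ _ that(6-8)] star_edge[OF that(1,3)]
          star_edge[OF that(2,4)] cs[OF that(1,3)] cs[OF that(2,4)] that(5)
        by simp
      show "\<phi> {g 0 h, v 0 h} \<in> {1..s}" if "h \<in> W" for h
        using col star_edge[OF that] by simp
    qed (fact W E)+
    show False
      using small_component big by (metis not_le)
  qed
qed

section \<open>The counterexample\<close>

lemma stack_layout_mono:
  assumes L: "stack_layout k G r \<phi>" and "k \<le> k'"
  shows "stack_layout k' G r \<phi>"
proof -
  have "\<forall>e\<in>edges G. \<phi> e \<in> {1..k}"
    using L unfolding stack_layout_def by (elim conjE)
  then have "\<forall>e\<in>edges G. \<phi> e \<in> {1..k'}"
    using \<open>k \<le> k'\<close> by auto
  then show ?thesis
    using L unfolding stack_layout_def by (elim conjE, intro conjI)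
qed

text \<open>The bound 8 is two stacks for each of four classes, whatever \<open>s\<close> is; only
  the sizes of the star and the grid depend on \<open>s\<close>.\<close>

lemma bounded_subdivision_of_large_stack_number:
  "\<exists>(G :: nat ugraph) G'. fin_simple_graph G \<and> le_subdivision 1 G G' \<and>
    stack_number G' \<le> 8 \<and> s < stack_number G"
proof -
  \<comment> \<open>The Hex lemma gives a component with at least \<open>p\<close> vertices, which
    must exceed \<open>2 * s\<close>. Coordinates range over \<open>0..p\<close>, hence the row
    length \<open>M\<close>.\<close>
  define p where "p = Suc (2 * s)"
  define M where "M = Suc p"
  define W where "W = hex_verts p"
  have adj: "hex_adj p \<subseteq> W \<times> W" "irrefl (hex_adj p)"
    by (auto simp: W_def hex_adj_def hex_arcs_def irrefl_def)
  have fin: "finite W"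
    by (simp add: W_def hex_verts_def)
  have big: "\<exists>x\<in>W. 2 * s < card ((mono_adj (hex_adj p) c)\<^sup>* `` {x})" for c
    using hex_lemma[of p c] by (auto simp: p_def W_def Suc_le_eq)
  then obtain a where a: "\<And>(G :: nat ugraph) g r \<phi>.
      contains_star_product a W (hex_adj p) g G \<Longrightarrow> \<not> stack_layout s G r \<phi>"
    using star_product_no_stack_layout[OF fin adj(1) sym_hex_adj adj(2) big, where 'v = nat] by blast
  define A where "A = Suc a"
  define N where "N = M * M * A"
  \<comment> \<open>Ignoring the sides of the grid and truncating the subtraction only adds edges, which is
    harmless for the lower bound.\<close>
  define f :: "nat \<Rightarrow> nat \<Rightarrow> nat" where
    "f c t = (if c = 0 then t div A * A else if c = 1 then t - A
      else if c = 2 then t - M * A else t - Suc M * A)" for c t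
  \<comment> \<open>The copies of one grid vertex fill a block of length \<open>A\<close> that
    begins with the centre, so rounding down to a multiple of \<open>A\<close> finds the centre. The
    steps (0,1), (1,0) and (1,1) add \<open>A\<close>, \<open>M * A\<close> and
    \<open>Suc M * A\<close>, which the other three functions undo.\<close>
  define g where "g i h = (fst h * M + snd h) * A + i" for i and h :: "nat \<times> nat"
  define G where "G = queue_graph 4 N f"
  have f: "mono (f c)" for c
    by (intro monoI) (auto simp: f_def intro: mult_right_mono div_le_mono diff_le_mono)
  have code: "fst h * M + snd h < M * M" if "h \<in> W" for h
  proof -
    have "fst h \<le> p" "snd h \<le> p"
      using that by (auto simp: W_def hex_verts_def)
    then have "fst h * M + snd h < fst h * M + M" "Suc (fst h) * M \<le> M * M"
      unfolding M_def by (simp, intro mult_right_mono) auto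
    then show ?thesis by simp
  qed
  have gN: "g i h < N" if "h \<in> W" "i \<le> a" for i h
  proof -
    have "g i h < Suc (fst h * M + snd h) * A"
      using that(2) by (simp add: g_def A_def)
    also have "\<dots> \<le> N"
      unfolding N_def using code[OF that(1)] by (intro mult_right_mono) auto
    finally show ?thesis .
  qed
  have g_div: "g i h div A = fst h * M + snd h" and g_mod: "g i h mod A = i" if "i \<le> a" for i h
  proof -
    have "i < A" using that by (simp add: A_def)
    then show "g i h div A = fst h * M + snd h" "g i h mod A = i"
      by (simp_all add: g_def)
  qed
  have "contains_star_product a W (hex_adj p) g G"
    unfolding contains_star_product_def
  proof (intro conjI ballI allI impI)
    show "inj_on (\<lambda>(i, h). g i h) ({..a} \<times> W)"
    proof (rule inj_onI)
      fix u w
      assume mem: "u \<in> {..a} \<times> W" "w \<in> {..a} \<times> W"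
        and eq: "(\<lambda>(i, h). g i h) u = (\<lambda>(i, h). g i h) w"
      obtain i x y j x' y' where uw: "u = (i, x, y)" "w = (j, x', y')"
        by (metis surj_pair)
      have "i \<le> a" "j \<le> a" "(x, y) \<in> W" "(x', y') \<in> W" "g i (x, y) = g j (x', y')"
        using mem eq by (simp_all add: uw)
      then have *: "i = j" "x * M + y = x' * M + y'" "y < M" "y' < M"
        using g_div[of i "(x, y)"] g_div[of j "(x', y')"] g_mod[of i "(x, y)"] g_mod[of j "(x', y')"]
        by (auto simp: W_def hex_verts_def M_def)
      then have "y = y'"
        by (metis mod_less mod_mult_self3)
      then show "u = w"
        using * by (simp add: uw)
    qed
    show "g i h \<in> verts G" if "i \<le> a" "h \<in> W" for i h
      using gN that by (simp add: G_def queue_graph_def)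
    show "{g 0 h, g i h} \<in> edges G" if "i \<in> {1..a}" "h \<in> W" for i h
      unfolding G_def
    proof (rule queue_graph_edgeI[of 0])
      show "f 0 (g i h) = g 0 h"
        using g_div[of i h] that by (simp add: f_def g_def)
      show "g 0 h < g i h"
        using that by (simp add: g_def)
    qed (use gN that in auto)
    have arc: "{g i h, g i h'} \<in> edges G" if "i \<le> a" "(h, h') \<in> hex_arcs p" for i h h'
    proof -
      obtain x y x' y' where h: "h = (x, y)" "h' = (x', y')"
        by (cases h; cases h')
      have W': "h' \<in> W" and xy: "x' = x \<or> x' = Suc x" "y' = y \<or> y' = Suc y" "x' = Suc x \<or> y' = Suc y"
        using that(2) by (auto simp: W_def hex_arcs_def h)
      then consider "x' = x" "y' = Suc y" | "x' = Suc x" "y' = y" | "x' = Suc x" "y' = Suc y"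
        by blast
      then have "\<exists>c<4. f c (g i h') = g i h \<and> g i h < g i h'"
      proof cases
        case 1
        then show ?thesis
          by (intro exI[of _ 1]) (simp add: f_def g_def h A_def algebra_simps)
      next
        case 2
        then show ?thesis
          by (intro exI[of _ 2]) (simp add: f_def g_def h A_def M_def algebra_simps)
      next
        case 3
        then show ?thesis
          by (intro exI[of _ 3]) (simp add: f_def g_def h A_def M_def algebra_simps)
      qed
      then show ?thesis
        using queue_graph_edgeI gN[OF W' that(1)] unfolding G_def by blast
    qed
    show "case e of (h, h') \<Rightarrow> {g i h, g i h'} \<in> edges G" if "i \<in> {1..a}" "e \<in> hex_adj p" for i e
      using that arc[of i "fst e" "snd e"] arc[of i "snd e" "fst e"]
      by (auto simp: hex_adj_def insert_commute)
  qed
  then have none: "\<not> stack_layout s G r \<phi>" for r \<phi>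
    by (rule a)
  have "fin_simple_graph G"
    unfolding G_def by (rule fin_simple_queue_graph)
  then have "\<exists>t r \<phi>. stack_layout t G r \<phi>"
    by (rule ex_stack_layout)
  then have "\<exists>r \<phi>. stack_layout (stack_number G) G r \<phi>"
    unfolding stack_number_def by (rule LeastI_ex)
  then obtain r \<phi> where L: "stack_layout (stack_number G) G r \<phi>"
    by blast
  have "s < stack_number G"
  proof (rule ccontr)
    assume "\<not> ?thesis"
    then have "stack_layout s G r \<phi>"
      using stack_layout_mono[OF L] by simp
    then show False
      using none by blast
  qed
  moreover obtain G' r' \<phi>' where sub: "le_subdivision 1 G G'" "stack_layout (2 * 4) G' r' \<phi>'"
    using queue_graph_subdivision[of 4 f N] f unfolding G_def by blast
  have "stack_number G' \<le> 2 * 4"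
    unfolding stack_number_def by (rule Least_le) (use sub(2) in blast)
  ultimately show ?thesis
    using \<open>fin_simple_graph G\<close> sub(1) by auto
qed

theorem mainTheorem3:
  shows "\<not> (\<exists>f :: int \<Rightarrow> int \<Rightarrow> real. \<forall>(G :: nat ugraph) (k :: int) (G' :: nat ugraph).
    fin_simple_graph G \<longrightarrow> le_subdivision k G G' \<longrightarrow>
    real (stack_number G) \<le> f (int (stack_number G')) k)"
proof
  assume "\<exists>f :: int \<Rightarrow> int \<Rightarrow> real. \<forall>(G :: nat ugraph) (k :: int) (G' :: nat ugraph).
    fin_simple_graph G \<longrightarrow> le_subdivision k G G' \<longrightarrow>
    real (stack_number G) \<le> f (int (stack_number G')) k"
  then obtain f :: "int \<Rightarrow> int \<Rightarrow> real" where f: "\<And>(G :: nat ugraph) k (G' :: nat ugraph).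
      fin_simple_graph G \<Longrightarrow> le_subdivision k G G' \<Longrightarrow>
      real (stack_number G) \<le> f (int (stack_number G')) k"
    by blast
  \<comment> \<open>With \<open>k = 1\<close> and at most 8 stacks for the subdivision, only nine
    values of \<open>f\<close> can occur.\<close>
  define B where "B = Max ((\<lambda>n. f (int n) 1) ` {..8})"
  obtain s where s: "B \<le> real s"
    using real_arch_simple by blast
  obtain G G' :: "nat ugraph" where G: "fin_simple_graph G" "le_subdivision 1 G G'"
      "stack_number G' \<le> 8" "s < stack_number G"
    using bounded_subdivision_of_large_stack_number by blast
  have "real (stack_number G) \<le> f (int (stack_number G')) 1"
    using f G by blast
  also have "\<dots> \<le> B"
    unfolding B_def using G(3) by (intro Max_ge) auto
  finally show False
    using s G(4) by simp
qed


end
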